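(* Let $a,b$ be coprime positive integers and fix $k$ with $0\le k<b$. Consider chip configurations on the complete graph with sink $0$ and non-sink vertices $[b]$, with the quantized cluster-fire and borrow moves described in the context. (a) For any chip configuration $D\in\mathbb{Z}^b$, there exists a unique $k$-skeletal chip configuration $D'$ reachable from $D$ via a finite sequence of (not necessarily legal) cluster-fire moves and borrow moves. If $D\ge 0$, then $D$ can be converted to $D'$ using a finite sequence of moves that are all legal. (b) Assume $b>1$. The map $D\mapsto D'$ with $D'(i)=a-1-\lfloor a/b\rfloor-D(i)$ for $i\in[b]$ is a bijection from the set of superstable configurations to the set of $0$-skeletal configurations. (c) There are exactly $a^{b-1}$ $k$-skeletal chip configurations. (d) Let the symmetric group $S_b$ act on chip configurations by permuting the vertices $[b]$. The number of $S_b$-orbits of $k$-skeletal chip configurations is $\frac{1}{a+b}\binom{a+b}{a}$.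
   Context: Fix coprime positive integers $a,b$ and write $[b]=\{1,\dots,b\}$. A chip configuration is a function $D:[b]\to\mathbb{Z}$, identified with the vector $(D(1),\dots,D(b))\in\mathbb{Z}^b$; write $D\ge 0$ if $D(i)\ge 0$ for all $i$. For $S\subseteq[b]$ with $|S|=s$, the cluster-fire move $\phi_S$ sends $D$ to the configuration obtained by subtracting $1+\lfloor (b-s)a/b\rfloor$ from $D(i)$ for each $i\in S$ and adding $\lfloor sa/b\rfloor$ to $D(j)$ for each $j\in[b]\setminus S$ ($\phi_\varnothing$ is the identity). The borrow move $\beta_S$ is the inverse map $\phi_S^{-1}$. For $D\ge 0$, the move $\phi_S$ (resp. $\beta_S$) is legal on $D$ if $\phi_S(D)\ge 0$ (resp. $\beta_S(D)\ge0$). For $0\le k<b$, a $k$-firing move is a move $\phi_S$ with $0<|S|\le k+1$; a configuration $D\ge 0$ is $k$-stable if no $k$-firing move is legal on $D$; superstable means $(b-1)$-stable. A configuration $D$ is $k$-skeletal if $D$ is $k$-stable and, for every nonempty $T\subseteq[b]$ such that $\beta_T$ is legal on $D$, the configuration $\beta_T(D)$ is not $k$-stable. *)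

theory Defs
  imports Complex_Main "HOL-Algebra.Sym_Groups" "HOL-Algebra.Group_Action"
begin

text \<open>
  Chip configurations on the non-sink vertices \<open>{1..b}\<close> of the complete graph with sink \<open>0\<close>.
  They are extensional functions (equal to \<^const>\<open>undefined\<close> outside \<open>{1..b}\<close>), so that equality
  and cardinality are those of integer vectors of length \<open>b\<close>.
\<close>

definition configs :: "nat \<Rightarrow> (nat \<Rightarrow> int) set" where
  "configs b = {1..b} \<rightarrow>\<^sub>E UNIV"

definition nonneg :: "nat \<Rightarrow> (nat \<Rightarrow> int) \<Rightarrow> bool" where
  "nonneg b D \<longleftrightarrow> (\<forall>i\<in>{1..b}. 0 \<le> D i)"

text \<open>
  The floors are written with \<open>div\<close>, which rounds down on \<^typ>\<open>int\<close>.
  All uses have \<open>S \<subseteq> {1..b}\<close>; for \<open>S = {}\<close> the formula gives the identity.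
\<close>

definition fire :: "nat \<Rightarrow> nat \<Rightarrow> nat set \<Rightarrow> (nat \<Rightarrow> int) \<Rightarrow> (nat \<Rightarrow> int)" where
  "fire a b S D = (\<lambda>i\<in>{1..b}.
     if i \<in> S then D i - (1 + ((int b - int (card S)) * int a) div int b)
     else D i + (int (card S) * int a) div int b)"

definition borrow :: "nat \<Rightarrow> nat \<Rightarrow> nat set \<Rightarrow> (nat \<Rightarrow> int) \<Rightarrow> (nat \<Rightarrow> int)" where
  "borrow a b S = inv_into (configs b) (fire a b S)"

definition legal :: "nat \<Rightarrow> ((nat \<Rightarrow> int) \<Rightarrow> (nat \<Rightarrow> int)) \<Rightarrow> (nat \<Rightarrow> int) \<Rightarrow> bool" where
  "legal b m D \<longleftrightarrow> nonneg b D \<and> nonneg b (m D)"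

definition stable :: "nat \<Rightarrow> nat \<Rightarrow> nat \<Rightarrow> (nat \<Rightarrow> int) \<Rightarrow> bool" where
  "stable a b k D \<longleftrightarrow> D \<in> configs b \<and> nonneg b D \<and>
     (\<forall>S\<subseteq>{1..b}. 0 < card S \<and> card S \<le> k + 1 \<longrightarrow> \<not> legal b (fire a b S) D)"

definition superstable :: "nat \<Rightarrow> nat \<Rightarrow> (nat \<Rightarrow> int) \<Rightarrow> bool" where
  "superstable a b D \<longleftrightarrow> stable a b (b - 1) D"

definition skeletal :: "nat \<Rightarrow> nat \<Rightarrow> nat \<Rightarrow> (nat \<Rightarrow> int) \<Rightarrow> bool" where
  "skeletal a b k D \<longleftrightarrow> stable a b k D \<and>
     (\<forall>T\<subseteq>{1..b}. T \<noteq> {} \<and> legal b (borrow a b T) D \<longrightarrow> \<not> stable a b k (borrow a b T D))"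

definition moves :: "nat \<Rightarrow> nat \<Rightarrow> ((nat \<Rightarrow> int) \<Rightarrow> (nat \<Rightarrow> int)) set" where
  "moves a b = fire a b ` Pow {1..b} \<union> borrow a b ` Pow {1..b}"

definition step :: "nat \<Rightarrow> nat \<Rightarrow> (nat \<Rightarrow> int) \<Rightarrow> (nat \<Rightarrow> int) \<Rightarrow> bool" where
  "step a b D D' \<longleftrightarrow> (\<exists>m\<in>moves a b. D' = m D)"

definition legal_step :: "nat \<Rightarrow> nat \<Rightarrow> (nat \<Rightarrow> int) \<Rightarrow> (nat \<Rightarrow> int) \<Rightarrow> bool" where
  "legal_step a b D D' \<longleftrightarrow> (\<exists>m\<in>moves a b. legal b m D \<and> D' = m D)"

text \<open>
  Vertex \<open>i\<close> of \<open>D\<close> is moved to vertex \<open>p i\<close>; the inverse makes this a left action.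
  It is restricted to \<^term>\<open>configs b\<close> as required by \<^locale>\<open>group_action\<close>.
\<close>

definition perm_act :: "nat \<Rightarrow> (nat \<Rightarrow> nat) \<Rightarrow> (nat \<Rightarrow> int) \<Rightarrow> (nat \<Rightarrow> int)" where
  "perm_act b p = (\<lambda>D\<in>configs b. D \<circ> inv_into UNIV p)"

lemma fire_in_configs: "fire a b S D \<in> configs b"
  by (simp add: configs_def fire_def)

lemma fire_bij: "bij_betw (fire a b S) (configs b) (configs b)"
proof (rule bij_betwI[where g = "\<lambda>D. \<lambda>i\<in>{1..b}.
     if i \<in> S then D i + (1 + ((int b - int (card S)) * int a) div int b)
     else D i - (int (card S) * int a) div int b"])
  fix D assume "D \<in> configs b"
  then have D: "D \<in> extensional {1..b}"
    by (simp add: configs_def PiE_def)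
  show "(\<lambda>i\<in>{1..b}.
     if i \<in> S then fire a b S D i + (1 + ((int b - int (card S)) * int a) div int b)
     else fire a b S D i - (int (card S) * int a) div int b) = D"
    by (rule extensionalityI[OF _ D]) (auto simp: fire_def)
  show "fire a b S (\<lambda>i\<in>{1..b}.
     if i \<in> S then D i + (1 + ((int b - int (card S)) * int a) div int b)
     else D i - (int (card S) * int a) div int b) = D"
    by (rule extensionalityI[OF _ D]) (auto simp: fire_def)
qed (auto simp: configs_def fire_def)

lemma borrow_eq:
  assumes "D \<in> configs b"
  shows "borrow a b S D = (\<lambda>i\<in>{1..b}.
     if i \<in> S then D i + (1 + ((int b - int (card S)) * int a) div int b)
     else D i - (int (card S) * int a) div int b)" (is "_ = ?E")
proof -
  have E: "?E \<in> configs b"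
    by (simp add: configs_def)
  have D: "D \<in> extensional {1..b}"
    using assms by (simp add: configs_def PiE_def)
  have "fire a b S ?E = D"
    by (rule extensionalityI[OF _ D]) (auto simp: fire_def)
  then show ?thesis
    using inv_into_f_f[OF bij_betw_imp_inj_on[OF fire_bij[of a b S]] E]
    by (simp add: borrow_def)
qed

lemma perm_act_in_configs:
  assumes "p permutes {1..b}" "D \<in> configs b"
  shows "D \<circ> inv_into UNIV p \<in> configs b"
proof -
  have "D (inv_into UNIV p i) = undefined" if "i \<notin> {1..b}" for i
    using that assms permutes_not_in[OF permutes_inv[OF assms(1)]]
    by (metis PiE_arb configs_def)
  then show ?thesis
    by (auto simp: configs_def PiE_def extensional_def)
qed

lemma perm_act_comp:
  assumes "p permutes {1..b}" "q permutes {1..b}" "D \<in> configs b"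
  shows "perm_act b (p \<circ> q) D = perm_act b p (perm_act b q D)"
  using assms perm_act_in_configs[OF assms(2,3)]
  by (simp add: perm_act_def o_inv_distrib permutes_bij comp_assoc)

lemma perm_act_Bij:
  assumes p: "p permutes {1..b}"
  shows "perm_act b p \<in> Bij (configs b)"
proof -
  note ip = permutes_inv[OF p]
  have "bij_betw (perm_act b p) (configs b) (configs b)"
  proof (rule bij_betwI[where g = "perm_act b (inv_into UNIV p)"])
    fix D assume D: "D \<in> configs b"
    have "perm_act b id D = D"
      using D by (simp add: perm_act_def)
    then show "perm_act b (inv_into UNIV p) (perm_act b p D) = D"
      and "perm_act b p (perm_act b (inv_into UNIV p) D) = D"
      using perm_act_comp[OF ip p D] perm_act_comp[OF p ip D] permutes_inv_o[OF p] by simp_all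
  qed (use perm_act_in_configs[OF p] perm_act_in_configs[OF ip] in \<open>simp_all add: perm_act_def\<close>)
  then show ?thesis
    by (simp add: Bij_def perm_act_def)
qed

lemma perm_act_group_action: "group_action (sym_group b) (configs b) (perm_act b)"
proof (unfold group_action_def group_hom_def group_hom_axioms_def, intro conjI homI)
  show "group (sym_group b)" "group (BijGroup (configs b))"
    by (rule sym_group_is_group, rule group_BijGroup)
  fix p q assume "p \<in> carrier (sym_group b)" "q \<in> carrier (sym_group b)"
  then have p: "p permutes {1..b}" and q: "q permutes {1..b}"
    by (simp_all add: sym_group_carrier)
  show "perm_act b p \<in> carrier (BijGroup (configs b))"
    using perm_act_Bij[OF p] by (simp add: BijGroup_def)
  have "perm_act b (p \<circ> q) = compose (configs b) (perm_act b p) (perm_act b q)"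
  proof (rule extensionalityI[of _ "configs b"])
    show "perm_act b (p \<circ> q) \<in> extensional (configs b)"
      by (simp add: perm_act_def)
  qed (simp_all add: perm_act_comp[OF p q] compose_def)
  then show "perm_act b (p \<otimes>\<^bsub>sym_group b\<^esub> q)
      = perm_act b p \<otimes>\<^bsub>BijGroup (configs b)\<^esub> perm_act b q"
    using perm_act_Bij[OF p] perm_act_Bij[OF q] by (simp add: sym_group_mult BijGroup_def)
qed

end

theory Submission
  imports Defs "HOL-Number_Theory.Cong"
begin

text \<open>
  The moves generate translation by the all-ones vector and by \<open>a\<close> times each unit vector, so
  reachability preserves the class of a configuration in \<open>(Z/a)^b\<close> modulo the all-ones vector.
  Stable configurations have entries in \<open>{0..<a}\<close>, hence the candidates in the class of \<open>v\<close> are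
  \<open>rot v c = (v + c) mod a\<close>, one for each \<open>c\<close> in \<open>Z/a\<close>. Put \<open>h c\<close> for the number of chips of
  \<open>rot v c\<close>. Then \<open>rot v c\<close> is \<open>k\<close>-stable iff \<open>h c \<le> h (c + n)\<close> for all \<open>0 \<le> n < (k + 1) a / b\<close>.
  Since \<open>h\<close> increases by at most \<open>b\<close> per step, from a \<open>k\<close>-stable \<open>rot v c\<close> that does not maximize
  \<open>h\<close> among the \<open>k\<close>-stable ones there is a \<open>k\<close>-stable \<open>rot v c'\<close> with \<open>0 < h c' - h c \<le> b\<close>, and
  exactly such jumps are single borrow moves. So skeletal means maximal, and \<open>h\<close> is injective on
  \<open>Z/a\<close> because \<open>a\<close> and \<open>b\<close> are coprime.

  For the counts, each class contains exactly one vector with entries in \<open>{0..<a}\<close> and sum divisible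
  by \<open>a\<close>; among all vectors (or all multisets of size \<open>b\<close>) over \<open>{0..<a}\<close> these are one in \<open>a\<close>.
\<close>

section \<open>Explicit form of the moves\<close>

definition chips :: "nat \<Rightarrow> (nat \<Rightarrow> int) \<Rightarrow> int" where
  "chips b D = (\<Sum>i\<in>{1..b}. D i)"

text \<open>For \<open>s > 0\<close> this is \<open>\<lceil>s a / b\<rceil> - 1\<close>, so that firing or borrowing a nonempty \<open>S\<close> has one
  formula that also covers \<open>S = {1..b}\<close>, where \<open>\<lfloor>s a / b\<rfloor>\<close> would be off by one.\<close>

definition gain :: "nat \<Rightarrow> nat \<Rightarrow> nat \<Rightarrow> int" where
  "gain a b s = (int s * int a - 1) div int b"

definition residues :: "nat \<Rightarrow> nat \<Rightarrow> (nat \<Rightarrow> int) set" where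
  "residues a b = {1..b} \<rightarrow>\<^sub>E {0..<int a}"

definition rot :: "nat \<Rightarrow> nat \<Rightarrow> (nat \<Rightarrow> int) \<Rightarrow> int \<Rightarrow> (nat \<Rightarrow> int)" where
  "rot a b D c = (\<lambda>i\<in>{1..b}. (D i + c) mod int a)"

text \<open>For \<open>b > 1\<close>, the constant \<open>int a - 1 - int a div int b\<close> bounds
  every entry of a stable configuration from above, so complementing against it keeps such
  configurations nonnegative.\<close>

definition dual :: "nat \<Rightarrow> nat \<Rightarrow> (nat \<Rightarrow> int) \<Rightarrow> (nat \<Rightarrow> int)" where
  "dual a b D = (\<lambda>i\<in>{1..b}. int a - 1 - int a div int b - D i)"

definition shift_cong :: "nat \<Rightarrow> nat \<Rightarrow> (nat \<Rightarrow> int) \<Rightarrow> (nat \<Rightarrow> int) \<Rightarrow> bool" where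
  "shift_cong a b D E \<longleftrightarrow> (\<exists>c. \<forall>i\<in>{1..b}. [E i = D i + c] (mod int a))"

lemma configs_eqI:
  assumes "D \<in> configs b" "E \<in> configs b" "\<And>i. i \<in> {1..b} \<Longrightarrow> D i = E i"
  shows "D = E"
  using assms unfolding configs_def by (blast intro: PiE_ext)

lemma residues_configs: "v \<in> residues a b \<Longrightarrow> v \<in> configs b"
  by (auto simp: residues_def configs_def)

lemma residues_nonneg: "v \<in> residues a b \<Longrightarrow> nonneg b v"
  by (auto simp: residues_def nonneg_def)

lemma rot_configs: "rot a b D c \<in> configs b"
  by (simp add: rot_def configs_def)

lemma borrow_in_configs: "D \<in> configs b \<Longrightarrow> borrow a b S D \<in> configs b"
  by (simp add: borrow_eq configs_def)

lemma fire_borrow: "D \<in> configs b \<Longrightarrow> fire a b S (borrow a b S D) = D"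
  unfolding borrow_def
  using bij_betw_imp_surj_on[OF fire_bij[of a b S]] by (metis f_inv_into_f)

lemma borrow_fire: "D \<in> configs b \<Longrightarrow> borrow a b S (fire a b S D) = D"
  unfolding borrow_def
  by (rule inv_into_f_f[OF bij_betw_imp_inj_on[OF fire_bij]])

lemma nonneg_chips: "nonneg b D \<Longrightarrow> 0 \<le> chips b D"
  unfolding nonneg_def chips_def by (blast intro: sum_nonneg)

lemma legal_steps_imp_steps: "(legal_step a b)\<^sup>*\<^sup>* D E \<Longrightarrow> (step a b)\<^sup>*\<^sup>* D E"
proof (erule rtranclp_mono[THEN predicate2D, rotated], rule predicate2I)
  show "legal_step a b x y \<Longrightarrow> step a b x y" for x y
    unfolding legal_step_def step_def by blast
qed

section \<open>Congruence up to a common shift, and rotation within a class\<close>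

lemma shift_cong_refl: "shift_cong a b D D"
  unfolding shift_cong_def by (rule exI[of _ 0]) simp

lemma shift_cong_sym:
  assumes "shift_cong a b D E" shows "shift_cong a b E D"
proof -
  obtain c where "\<forall>i\<in>{1..b}. [E i = D i + c] (mod int a)"
    using assms unfolding shift_cong_def by blast
  then have "\<forall>i\<in>{1..b}. [D i = E i + - c] (mod int a)"
    by (auto simp: cong_iff_dvd_diff algebra_simps dvd_diff_commute[of _ "_ + _"])
  then show ?thesis unfolding shift_cong_def by blast
qed

lemma shift_cong_trans:
  assumes "shift_cong a b D E" "shift_cong a b E F" shows "shift_cong a b D F"
proof -
  obtain c d where c: "\<And>i. i \<in> {1..b} \<Longrightarrow> [E i = D i + c] (mod int a)"
    and d: "\<And>i. i \<in> {1..b} \<Longrightarrow> [F i = E i + d] (mod int a)"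
    using assms unfolding shift_cong_def by blast
  have "[F i = D i + (c + d)] (mod int a)" if "i \<in> {1..b}" for i
    using cong_trans[OF d[OF that] cong_add[OF c[OF that] cong_refl[of d]]]
    by (simp add: add.assoc)
  then show ?thesis unfolding shift_cong_def by blast
qed

lemma inj_on_dual: "inj_on (dual a b) (configs b)"
proof (rule inj_onI)
  fix D E assume DE: "D \<in> configs b" "E \<in> configs b" and eq: "dual a b D = dual a b E"
  show "D = E"
  proof (rule configs_eqI[OF DE])
    fix i assume "i \<in> {1..b}"
    then show "D i = E i" using fun_cong[OF eq, of i] by (simp add: dual_def)
  qed
qed

lemma rot_shift_cong: "shift_cong a b D (rot a b D c)"
  unfolding shift_cong_def rot_def by (rule exI[of _ c]) simp

lemma shift_cong_imp_rot:
  assumes "E \<in> residues a b" "shift_cong a b D E"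
  obtains c where "E = rot a b D c"
proof -
  obtain c where c: "\<And>i. i \<in> {1..b} \<Longrightarrow> [E i = D i + c] (mod int a)"
    using assms(2) unfolding shift_cong_def by blast
  have "E = rot a b D c"
  proof (rule configs_eqI[OF residues_configs[OF assms(1)] rot_configs])
    fix i assume i: "i \<in> {1..b}"
    then have "E i \<in> {0..<int a}"
      using assms(1) by (auto simp: residues_def)
    then have "E i mod int a = E i" by simp
    with c[OF i] i show "E i = rot a b D c i"
      by (simp add: rot_def cong_def)
  qed
  then show ?thesis by (rule that)
qed

lemma rot_rot: "rot a b (rot a b D c) d = rot a b D (c + d)"
  by (rule configs_eqI[OF rot_configs rot_configs]) (simp add: rot_def mod_simps add.assoc)

lemma rot_0: "v \<in> residues a b \<Longrightarrow> rot a b v 0 = v"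
  by (rule configs_eqI[OF rot_configs residues_configs]) (auto simp: rot_def residues_def PiE_iff)

lemma rot_mod: "rot a b D (c mod int a) = rot a b D c"
  by (rule configs_eqI[OF rot_configs rot_configs]) (simp add: rot_def mod_simps)

lemma chips_rot_cong: "[chips b (rot a b D c) = chips b D + int b * c] (mod int a)"
proof -
  have "[chips b (rot a b D c) = (\<Sum>i\<in>{1..b}. D i + c)] (mod int a)"
    unfolding chips_def by (rule cong_sum) (simp add: rot_def)
  then show ?thesis
    by (simp add: chips_def sum.distrib)
qed

lemma legal_stepI:
  assumes "T \<subseteq> {1..b}"
  shows "legal b (fire a b T) D \<Longrightarrow> legal_step a b D (fire a b T D)"
    and "legal b (borrow a b T) D \<Longrightarrow> legal_step a b D (borrow a b T D)"
  using assms unfolding legal_step_def moves_def by auto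

lemma chips_residues_le:
  assumes "v \<in> residues a b" shows "chips b v \<le> int b * int a"
proof -
  have "chips b v \<le> (\<Sum>i\<in>{1..b}. int a)"
    unfolding chips_def using assms by (intro sum_mono) (auto simp: residues_def PiE_iff less_imp_le)
  then show ?thesis by simp
qed

lemma proper_card:
  assumes "S \<subseteq> {1..b}" "i \<in> {1..b}" "i \<notin> S"
  shows "card S < b"
proof -
  have "card S < card {1..b}" using assms by (intro psubset_card_mono) auto
  then show ?thesis by simp
qed

lemma card_range:
  assumes "S \<subseteq> {1..b}" "S \<noteq> {}"
  shows "0 < card S" "card S \<le> b"
  using assms card_mono[OF _ assms(1)] finite_subset[OF assms(1)] by (auto simp: card_gt_0_iff)

lemma fire_empty: "D \<in> configs b \<Longrightarrow> fire a b {} D = D"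
  by (rule configs_eqI[OF fire_in_configs]) (auto simp: fire_def)

text \<open>After a legal borrow of \<open>T\<close>, firing \<open>T\<close> is legal again because
  it leads back to \<open>D\<close>. Every nonempty \<open>T\<close> is small enough to count as a
  \<open>(b - 1)\<close>-firing set, so no legal borrow yields a \<open>(b - 1)\<close>-stable
  configuration.\<close>

lemma superstable_iff_skeletal: "superstable a b D \<longleftrightarrow> skeletal a b (b - 1) D"
proof
  assume D: "superstable a b D"
  have "\<not> stable a b (b - 1) (borrow a b T D)"
    if T: "T \<subseteq> {1..b}" "T \<noteq> {}" "legal b (borrow a b T) D" for T
  proof -
    have "legal b (fire a b T) (borrow a b T D)"
      using T(3) D fire_borrow[of D b a T] by (simp add: legal_def superstable_def stable_def)
    then show ?thesis using T card_range[OF T(1,2)] unfolding stable_def by auto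
  qed
  then show "skeletal a b (b - 1) D"
    using D by (simp add: skeletal_def superstable_def)
qed (simp add: skeletal_def superstable_def)

text \<open>The last index before \<open>m\<close> with value at most \<open>h 0\<close> is followed by a jump of at most \<open>B\<close>, and
  \<open>q\<close> is a minimizer between that index and \<open>m\<close>.\<close>

lemma crossing_minimizer:
  fixes h :: "int \<Rightarrow> int"
  assumes m: "0 < m" "h 0 < h m" and jump: "\<And>j. h (j + 1) \<le> h j + B"
  obtains q where "0 < q" "q \<le> m" "h 0 < h q" "h q \<le> h 0 + B"
    "\<And>j. q \<le> j \<Longrightarrow> j \<le> m \<Longrightarrow> h q \<le> h j"
proof -
  define P where "P = {j\<in>{0..m}. h j \<le> h 0}"
  define p where "p = Max P"
  have "P \<subseteq> {0..m}" by (auto simp: P_def)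
  then have P: "finite P" "0 \<in> P" using m(1) finite_subset by (blast, simp add: P_def)
  then have pP: "p \<in> P" unfolding p_def by (intro Max_in) auto
  then have p: "0 \<le> p" "p \<le> m" "h p \<le> h 0" by (auto simp: P_def)
  have "p \<noteq> m" using p(3) m(2) by auto
  then have pm: "p < m" using p(2) by simp
  have above: "h 0 < h j" if "p < j" "j \<le> m" for j
  proof (rule ccontr)
    assume "\<not> h 0 < h j"
    then have "j \<in> P" using that p(1) by (simp add: P_def)
    then have "j \<le> p" unfolding p_def using P(1) by simp
    then show False using that(1) by simp
  qed
  obtain q where q: "q \<in> {p+1..m}" "\<forall>j\<in>{p+1..m}. h q \<le> h j"
    using ex_is_arg_min_if_finite[of "{p+1..m}" h] pm by (auto simp: is_arg_min_linorder)
  show ?thesis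
  proof (rule that[of q])
    show "h q \<le> h 0 + B" using q(2) pm jump[of p] p(3) by (force dest: bspec[of _ _ "p + 1"])
  qed (use q above p(1) in auto)
qed

context
  fixes a b :: nat
  assumes a_pos: "0 < a" and b_pos: "0 < b" and coprime_ab: "coprime a b"
begin

lemma rot_residues: "rot a b D c \<in> residues a b"
  using a_pos by (simp add: rot_def residues_def)

section \<open>Arithmetic of \<open>gain\<close> and its effect on the moves\<close>

lemma gain_bounds: "int b * gain a b s < int s * int a" "int s * int a \<le> int b * (gain a b s + 1)"
proof -
  have "int b * ((int s * int a - 1) div int b) + (int s * int a - 1) mod int b = int s * int a - 1"
    by simp
  moreover have "0 \<le> (int s * int a - 1) mod int b" "(int s * int a - 1) mod int b < int b"
    using b_pos by auto
  ultimately show "int b * gain a b s < int s * int a" "int s * int a \<le> int b * (gain a b s + 1)"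
    unfolding gain_def distrib_left by linarith+
qed

lemma b_less_cancel: "int b * x < int b * y \<Longrightarrow> x < y"
  using b_pos by simp

text \<open>The intervals from \<open>b n\<close> (exclusive) to \<open>b (n + 1)\<close>
  (inclusive) are disjoint, and by \<open>gain_bounds\<close> the value of \<open>gain\<close> names
  the one containing \<open>s a\<close>.\<close>

lemma gain_eqI:
  assumes "int b * n < int s * int a" "int s * int a \<le> int b * (n + 1)"
  shows "gain a b s = n"
proof -
  have "int b * n < int b * (gain a b s + 1)" "int b * gain a b s < int b * (n + 1)"
    using assms gain_bounds[of s] by linarith+
  then show ?thesis using b_pos by simp
qed

lemma gain_range:
  assumes "0 < s" "s \<le> b"
  shows "0 \<le> gain a b s" "gain a b s < int a"
proof -
  have "0 < int s * int a" using assms a_pos by simp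
  then have "int b * 0 < int b * (gain a b s + 1)" using gain_bounds(2)[of s] by linarith
  then show "0 \<le> gain a b s" using b_less_cancel by fastforce
  have "int s * int a \<le> int b * int a" using assms by (intro mult_right_mono) auto
  then have "int b * gain a b s < int b * int a" using gain_bounds(1)[of s] by linarith
  then show "gain a b s < int a" using b_less_cancel by fastforce
qed

lemma fire_cost: "1 + ((int b - int s) * int a) div int b = int a - gain a b s"
proof -
  have "((int b - int s) * int a) div int b = int a - gain a b s - 1"
  proof (rule int_div_pos_eq)
    show "(int b - int s) * int a = int b * (int a - gain a b s - 1)
        + (int b * (gain a b s + 1) - int s * int a)"
      by (simp add: algebra_simps)
  qed (use gain_bounds[of s] in \<open>auto simp: algebra_simps\<close>)
  then show ?thesis by simp
qed

text \<open>Coprimality excludes that \<open>b\<close> divides \<open>s a\<close> for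
  \<open>0 < s < b\<close>, so the floor of \<open>s a / b\<close> is the ceiling minus one.\<close>

lemma gain_eq_div:
  assumes "0 < s" "s < b"
  shows "(int s * int a) div int b = gain a b s"
proof -
  have "\<not> int b dvd int s * int a"
  proof
    assume "int b dvd int s * int a"
    then have "b dvd s * a" by (metis of_nat_dvd_iff of_nat_mult)
    then have "b dvd s" using coprime_ab by (simp add: coprime_commute coprime_dvd_mult_left_iff)
    then show False using assms by (auto dest: dvd_imp_le)
  qed
  then have ne: "int s * int a \<noteq> int b * (gain a b s + 1)" by auto
  show ?thesis
  proof (rule int_div_pos_eq)
    show "int s * int a = int b * gain a b s + (int s * int a - int b * gain a b s)" by simp
  qed (use gain_bounds[of s] ne in \<open>auto simp: algebra_simps\<close>)
qed

text \<open>Firing becomes a uniform shift by \<open>gain\<close> followed by the removal of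
  \<open>a\<close> chips at each vertex of \<open>S\<close>. For \<open>S = {1..b}\<close>, where
  \<open>gain\<close> differs from the floor, no vertex lies outside \<open>S\<close>, so the floor
  never occurs.\<close>

lemma fire_apply:
  assumes "S \<subseteq> {1..b}" "S \<noteq> {}" "i \<in> {1..b}"
  shows "fire a b S D i = D i + gain a b (card S) - (if i \<in> S then int a else 0)"
proof (cases "i \<in> S")
  case True
  then show ?thesis using assms(3) fire_cost[of "card S"] by (simp add: fire_def)
next
  case False
  then show ?thesis
    using assms(3) gain_eq_div[OF card_range(1)[OF assms(1,2)] proper_card[OF assms(1,3) False]]
    by (simp add: fire_def)
qed

lemma borrow_apply:
  assumes "S \<subseteq> {1..b}" "S \<noteq> {}" "i \<in> {1..b}" "D \<in> configs b"
  shows "borrow a b S D i = D i - gain a b (card S) + (if i \<in> S then int a else 0)"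
  using fire_apply[OF assms(1-3), of "borrow a b S D"] fire_borrow[OF assms(4), of a S] by simp

lemma chips_fire:
  assumes "S \<subseteq> {1..b}" "S \<noteq> {}"
  shows "chips b (fire a b S D) = chips b D + int b * gain a b (card S) - int (card S) * int a"
proof -
  have "chips b (fire a b S D)
      = (\<Sum>i\<in>{1..b}. D i + gain a b (card S) - (if i \<in> S then int a else 0))"
    unfolding chips_def by (rule sum.cong[OF refl]) (rule fire_apply[OF assms])
  also have "\<dots> = chips b D + int b * gain a b (card S) - (\<Sum>i\<in>{1..b}. if i \<in> S then int a else 0)"
    by (simp add: chips_def sum.distrib sum_subtractf)
  also have "(\<Sum>i\<in>{1..b}. if i \<in> S then int a else 0) = int (card S) * int a"
    using assms(1) by (simp add: sum.If_cases Int_absorb1 Int_absorb2)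
  finally show ?thesis .
qed

text \<open>The sink receives \<open>s a - b * gain a b s\<close> chips with
  \<open>s = card S\<close>, which is positive by the strict bound in \<open>gain_bounds\<close>.
  This drives termination of firing.\<close>

lemma chips_fire_less:
  assumes "S \<subseteq> {1..b}" "S \<noteq> {}"
  shows "chips b (fire a b S D) < chips b D"
  using chips_fire[OF assms] gain_bounds(1)[of "card S"] by simp

lemma chips_borrow_less:
  assumes "S \<subseteq> {1..b}" "S \<noteq> {}" "D \<in> configs b"
  shows "chips b D < chips b (borrow a b S D)"
  using chips_fire_less[OF assms(1,2), of "borrow a b S D"] by (simp add: fire_borrow assms(3))

lemma nonneg_fire_iff:
  assumes "S \<subseteq> {1..b}" "S \<noteq> {}" "nonneg b D"
  shows "nonneg b (fire a b S D) \<longleftrightarrow> (\<forall>i\<in>S. int a - gain a b (card S) \<le> D i)"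
proof -
  have "0 \<le> D i + gain a b (card S)" if "i \<in> {1..b}" for i
    using assms(3) that gain_range(1)[OF card_range[OF assms(1,2)]] by (simp add: nonneg_def)
  then have "nonneg b (fire a b S D)
      \<longleftrightarrow> (\<forall>i\<in>{1..b}. i \<in> S \<longrightarrow> int a - gain a b (card S) \<le> D i)"
    unfolding nonneg_def by (auto simp: fire_apply[OF assms(1,2)] split: if_splits)
  also have "\<dots> \<longleftrightarrow> (\<forall>i\<in>S. int a - gain a b (card S) \<le> D i)"
    using assms(1) by blast
  finally show ?thesis .
qed

lemma fire_shift_cong:
  assumes "S \<subseteq> {1..b}" "D \<in> configs b"
  shows "shift_cong a b D (fire a b S D)"
proof (cases "S = {}")
  case True
  then show ?thesis by (simp add: fire_empty[OF assms(2)] shift_cong_refl)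
next
  case False
  show ?thesis unfolding shift_cong_def
    by (rule exI[of _ "gain a b (card S)"])
      (auto simp: fire_apply[OF assms(1) False] cong_iff_dvd_diff)
qed

lemma step_configs_shift_cong:
  assumes "step a b D D'" "D \<in> configs b"
  shows "D' \<in> configs b \<and> shift_cong a b D D'"
proof -
  obtain S where S: "S \<subseteq> {1..b}" "D' = fire a b S D \<or> D' = borrow a b S D"
    using assms(1) unfolding step_def moves_def by auto
  from S(2) show ?thesis
  proof
    assume "D' = fire a b S D"
    then show ?thesis using fire_shift_cong[OF S(1) assms(2)] fire_in_configs by simp
  next
    assume "D' = borrow a b S D"
    then show ?thesis
      using shift_cong_sym[OF fire_shift_cong[OF S(1) borrow_in_configs[OF assms(2), of a S]]]
        borrow_in_configs[OF assms(2)] fire_borrow[OF assms(2)] by simp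
  qed
qed

lemma steps_configs_shift_cong:
  assumes "(step a b)\<^sup>*\<^sup>* D D'" "D \<in> configs b"
  shows "D' \<in> configs b \<and> shift_cong a b D D'"
  using assms
proof (induction rule: rtranclp_induct)
  case base
  then show ?case by (simp add: shift_cong_refl)
next
  case (step E F)
  then show ?case using step_configs_shift_cong shift_cong_trans by blast
qed

section \<open>Stability as a one-sided minimality of the number of chips\<close>

text \<open>For \<open>0 \<le> n \<le> a\<close> an entry wraps at most once, and it does so when it
  is at least \<open>a - n\<close>. The result has the shape of \<open>fire_apply\<close>, with
  \<open>n\<close> in place of \<open>gain\<close> and the wrapping vertices in place of
  \<open>S\<close>.\<close>

lemma rot_apply:
  assumes "v \<in> residues a b" "0 \<le> n" "n \<le> int a" "i \<in> {1..b}"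
  shows "rot a b v n i = v i + n - (if int a - n \<le> v i then int a else 0)"
proof -
  have v: "0 \<le> v i" "v i < int a" using assms(1,4) by (auto simp: residues_def)
  show ?thesis
  proof (cases "int a - n \<le> v i")
    case True
    then have "(v i + n) mod int a = v i + n - int a"
      using v assms(3) by (intro int_mod_pos_eq[where q = 1]) auto
    then show ?thesis using True assms(4) by (simp add: rot_def)
  next
    case False
    then show ?thesis using v assms(2,4) by (simp add: rot_def)
  qed
qed

lemma chips_rot:
  assumes "v \<in> residues a b" "0 \<le> n" "n \<le> int a"
  shows "chips b (rot a b v n)
    = chips b v + int b * n - int a * int (card {i\<in>{1..b}. int a - n \<le> v i})"
proof -
  have "chips b (rot a b v n)
      = (\<Sum>i\<in>{1..b}. v i + n - (if int a - n \<le> v i then int a else 0))"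
    unfolding chips_def by (rule sum.cong[OF refl]) (rule rot_apply[OF assms])
  also have "\<dots> = chips b v + int b * n - (\<Sum>i\<in>{1..b}. if int a - n \<le> v i then int a else 0)"
    by (simp add: chips_def sum.distrib sum_subtractf)
  also have "(\<Sum>i\<in>{1..b}. if int a - n \<le> v i then int a else 0)
      = int a * int (card {i\<in>{1..b}. int a - n \<le> v i})"
    by (simp add: sum.If_cases Int_def)
  finally show ?thesis .
qed

lemma stable_below_gain:
  assumes "stable a b k D" "i \<in> {1..b}"
  shows "D i < int a - gain a b 1"
proof (rule ccontr)
  assume "\<not> ?thesis"
  then have "nonneg b (fire a b {i} D)"
    using assms by (subst nonneg_fire_iff) (auto simp: stable_def)
  then show False
    using assms unfolding stable_def legal_def by (auto dest!: spec[of _ "{i}"])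
qed

lemma stable_residues:
  assumes "stable a b k D" shows "D \<in> residues a b"
proof -
  have "D i < int a" if "i \<in> {1..b}" for i
    using stable_below_gain[OF assms that] gain_range(1)[of 1] b_pos by simp
  then show ?thesis
    using assms unfolding stable_def residues_def configs_def nonneg_def by (auto simp: PiE_iff)
qed

text \<open>Let \<open>W\<close> be the set of vertices that wrap under rotation by
  \<open>n\<close>; the rotation loses chips iff \<open>b n < a * card W\<close>. A loss lets a
  subset of \<open>W\<close> of size at most \<open>k + 1\<close> fire. Conversely, if
  \<open>S\<close> fires legally, all of \<open>S\<close> wraps for
  \<open>n = gain a b (card S)\<close>, which forces a loss.\<close>

lemma stable_iff_chips_le:
  assumes v: "v \<in> residues a b" and k: "k < b"
  shows "stable a b k v \<longleftrightarrow>
    (\<forall>n\<ge>0. int b * n < (int k + 1) * int a \<longrightarrow> chips b v \<le> chips b (rot a b v n))"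
    (is "?L \<longleftrightarrow> ?R")
proof
  have nn: "nonneg b v" using v by (auto simp: nonneg_def residues_def)
  {
    assume L: ?L
    show ?R
    proof (intro allI impI, rule ccontr)
      fix n :: int
      assume n: "0 \<le> n" "int b * n < (int k + 1) * int a"
        and "\<not> chips b v \<le> chips b (rot a b v n)"
      define W where "W = {i\<in>{1..b}. int a - n \<le> v i}"
      \<comment> \<open>Truncating at \<open>k + 1\<close> keeps the set admissible for
        \<open>k\<close>-firing, and the bound on \<open>n\<close> preserves
        \<open>b n < s a\<close>.\<close>
      define s where "s = min (card W) (k + 1)"
      have "(int k + 1) * int a \<le> int b * int a" using k by (intro mult_right_mono) auto
      then have "int b * n < int b * int a" using n by linarith
      then have na: "n \<le> int a" using b_pos by simp
      have W: "int b * n < int (card W) * int a"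
        using chips_rot[OF v n(1) na] \<open>\<not> _ \<le> _\<close> unfolding W_def by (simp add: mult.commute)
      then have sn: "int b * n < int s * int a" using n(2) by (simp add: s_def min_def add.commute)
      obtain S where S: "S \<subseteq> W" "card S = s"
        using obtain_subset_with_card_n[of s W] by (metis min.cobounded1 s_def)
      have "0 \<le> int b * n" using n(1) by simp
      then have "0 < int s * int a" using sn by linarith
      then have s0: "0 < s" using zero_less_mult_pos2 a_pos by fastforce
      have "int b * n < int b * (gain a b s + 1)" using sn gain_bounds(2)[of s] by linarith
      then have ng: "n \<le> gain a b s" using b_less_cancel by fastforce
      have Sb: "S \<subseteq> {1..b}" using S(1) by (auto simp: W_def)
      have "S \<noteq> {}" using S(2) s0 by auto
      moreover have "\<forall>i\<in>S. int a - gain a b (card S) \<le> v i"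
        using S ng by (fastforce simp: W_def)
      ultimately have "legal b (fire a b S) v"
        using nonneg_fire_iff[OF Sb _ nn] nn by (simp add: legal_def)
      then show False using L Sb S(2) s0 unfolding stable_def s_def by auto
    qed
  next
    assume R: ?R
    have "\<not> legal b (fire a b S) v" if S: "S \<subseteq> {1..b}" "0 < card S" "card S \<le> k + 1" for S
    proof
      assume "legal b (fire a b S) v"
      let ?n = "gain a b (card S)"
      have S0: "S \<noteq> {}" using S(2) by auto
      note range = gain_range[OF card_range[OF S(1) S0]]
      have "\<forall>i\<in>S. int a - ?n \<le> v i"
        using \<open>legal _ _ _\<close> nonneg_fire_iff[OF S(1) S0 nn] by (simp add: legal_def)
      then have "card S \<le> card {i\<in>{1..b}. int a - ?n \<le> v i}"
        using S(1) by (intro card_mono) auto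
      then have "int (card S) * int a \<le> int a * int (card {i\<in>{1..b}. int a - ?n \<le> v i})"
        by (subst mult.commute) (intro mult_left_mono, simp_all)
      then have "chips b (rot a b v ?n) < chips b v"
        using chips_rot[OF v range(1)] range(2) gain_bounds(1)[of "card S"] by simp
      moreover have "int (card S) * int a \<le> (int k + 1) * int a"
        using S(3) by (intro mult_right_mono) auto
      then have "int b * ?n < (int k + 1) * int a"
        using gain_bounds(1)[of "card S"] by linarith
      ultimately show False using R range(1) by fastforce
    qed
    then show ?L using nn residues_configs[OF v] by (simp add: stable_def)
  }
qed

section \<open>Uniqueness of skeletal configurations\<close>

text \<open>Rotating back from \<open>rot a b v q\<close> to \<open>v\<close> amounts to firing the
  set \<open>T\<close> of vertices that wrap on the way, provided that the shift \<open>n\<close>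
  equals \<open>gain a b (card T)\<close>. The bounds on the number of chips ensure this
  equality.\<close>

lemma borrow_to_rot:
  assumes v: "v \<in> residues a b"
    and "chips b v < chips b (rot a b v q)" "chips b (rot a b v q) \<le> chips b v + int b"
  obtains T where "T \<subseteq> {1..b}" "T \<noteq> {}" "borrow a b T v = rot a b v q"
proof -
  define w where "w = rot a b v q"
  define n where "n = (- q) mod int a"
  define T where "T = {i\<in>{1..b}. int a - n \<le> w i}"
  have w: "w \<in> residues a b" unfolding w_def by (rule rot_residues)
  have n: "0 \<le> n" "n \<le> int a" using a_pos by (auto simp: n_def less_imp_le)
  have "(q + n) mod int a = 0" by (simp add: n_def mod_simps)
  then have vw: "rot a b w n = v"
    using rot_mod[of a b v "q + n"] by (simp add: w_def rot_rot rot_0[OF v])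
  have cv: "chips b v = chips b w + int b * n - int (card T) * int a"
    using chips_rot[OF w n] unfolding vw T_def by (simp add: mult.commute)
  \<comment> \<open>A drop of at least 1 and at most \<open>b\<close> chips says
    \<open>b n < card T * a \<le> b (n + 1)\<close>.\<close>
  have g: "gain a b (card T) = n"
    using cv assms(2,3) unfolding w_def[symmetric] by (intro gain_eqI) (auto simp: distrib_left)
  have "0 \<le> int b * n" using n(1) by simp
  then have T0: "T \<noteq> {}" using cv assms(2) unfolding w_def[symmetric] by auto
  have Tb: "T \<subseteq> {1..b}" by (auto simp: T_def)
  have "borrow a b T v = w"
  proof (rule configs_eqI[OF borrow_in_configs residues_configs[OF w]])
    show "v \<in> configs b" by (rule residues_configs[OF v])
    fix i assume i: "i \<in> {1..b}"
    show "borrow a b T v i = w i"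
      using borrow_apply[OF Tb T0 i residues_configs[OF v]] rot_apply[OF w n i] i
      unfolding vw g by (auto simp: T_def split: if_splits)
  qed
  then show ?thesis using that Tb T0 by (simp add: w_def)
qed

text \<open>If \<open>E\<close> had more chips, \<open>crossing_minimizer\<close> would give a
  rotation of \<open>D\<close> with at least 1 and at most \<open>b\<close> more chips than
  \<open>D\<close>. This rotation is \<open>k\<close>-stable, and by \<open>borrow_to_rot\<close> it
  is one legal borrow away from \<open>D\<close>, which contradicts that \<open>D\<close> is
  skeletal.\<close>

lemma skeletal_chips_maximal:
  assumes D: "skeletal a b k D" and E: "stable a b k E" and "shift_cong a b D E" and k: "k < b"
  shows "chips b E \<le> chips b D"
proof (rule ccontr)
  assume less: "\<not> ?thesis"
  have Ds: "stable a b k D" using D by (simp add: skeletal_def)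
  note Dr = stable_residues[OF Ds]
  obtain c where c: "E = rot a b D c"
    using shift_cong_imp_rot[OF stable_residues[OF E] assms(3)] .
  define m where "m = c mod int a"
  define h where "h j = chips b (rot a b D j)" for j
  have Em: "E = rot a b D m" by (simp add: m_def rot_mod c)
  have h0: "h 0 = chips b D" by (simp add: h_def rot_0[OF Dr])
  have hm: "h 0 < h m" using less unfolding h0 by (simp add: h_def Em)
  have "0 \<le> m" using a_pos by (simp add: m_def)
  moreover have "m \<noteq> 0" using hm by auto
  ultimately have "0 < m" by simp
  \<comment> \<open>A rotation by 1 adds one chip per vertex, and wrapping only removes
    chips.\<close>
  have jump: "h (j + 1) \<le> h j + int b" for j
    using chips_rot[OF rot_residues, of 1 D j] a_pos by (simp add: h_def rot_rot)
  obtain q where q: "0 < q" "q \<le> m" "h 0 < h q" "h q \<le> h 0 + int b"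
    "\<And>j. q \<le> j \<Longrightarrow> j \<le> m \<Longrightarrow> h q \<le> h j"
    using crossing_minimizer[of m h "int b", OF \<open>0 < m\<close> hm jump] by blast
  have window: "h m \<le> h (m + n)" if "0 \<le> n" "int b * n < (int k + 1) * int a" for n
    using stable_iff_chips_le[OF stable_residues[OF E] k] E that by (simp add: Em rot_rot h_def)
  have "stable a b k (rot a b D q)"
  proof (subst stable_iff_chips_le[OF rot_residues k], intro allI impI)
    fix n :: int assume n: "0 \<le> n" "int b * n < (int k + 1) * int a"
    \<comment> \<open>Up to \<open>m\<close>, minimality of \<open>q\<close> suffices. Beyond
      \<open>m\<close>, the overshoot \<open>q + n - m\<close> is at most \<open>n\<close>, so
      stability of \<open>E\<close> bounds \<open>h m\<close> by the value there, and
      \<open>h q \<le> h m\<close>.\<close>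
    have "h q \<le> h (q + n)"
    proof (cases "q + n \<le> m")
      case True
      then show ?thesis using q(5) n(1) by simp
    next
      case False
      have "int b * (q + n - m) \<le> int b * n" using q(2) by (intro mult_left_mono) auto
      then have "h m \<le> h (m + (q + n - m))"
        using False n(2) by (intro window) linarith+
      then show ?thesis using q(5)[of m] q(2) by simp
    qed
    then show "chips b (rot a b D q) \<le> chips b (rot a b (rot a b D q) n)"
      by (simp add: h_def rot_rot)
  qed
  moreover obtain T where "T \<subseteq> {1..b}" "T \<noteq> {}" "borrow a b T D = rot a b D q"
    using borrow_to_rot[OF Dr] q(3,4) unfolding h0 unfolding h_def by metis
  ultimately show False
    using D residues_nonneg[OF Dr] residues_nonneg[OF rot_residues[of D q]]
    unfolding skeletal_def legal_def by metis
qed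

text \<open>The numbers of chips differ by \<open>b * c\<close> modulo \<open>a\<close>, and
  coprimality cancels \<open>b\<close>, so \<open>a\<close> divides \<open>c\<close>.\<close>

lemma rot_chips_eq_imp_eq:
  assumes v: "v \<in> residues a b" and "[chips b (rot a b v c) = chips b v] (mod int a)"
  shows "rot a b v c = v"
proof -
  have "[chips b v + int b * c = chips b v] (mod int a)"
    using cong_trans[OF cong_sym[OF chips_rot_cong] assms(2)] .
  then have "int a dvd int b * c" by (simp add: cong_add_lcancel_0 cong_0_iff)
  moreover have "coprime (int a) (int b)" using coprime_ab by simp
  ultimately have "c mod int a = 0" by (simp add: coprime_dvd_mult_right_iff)
  then show ?thesis using rot_mod[of a b v c] rot_0[OF v] by simp
qed

lemma skeletal_unique:
  assumes "skeletal a b k D" "skeletal a b k E" "shift_cong a b D E" "k < b"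
  shows "D = E"
proof -
  have st: "stable a b k D" "stable a b k E" using assms(1,2) by (simp_all add: skeletal_def)
  have "chips b D = chips b E"
    using skeletal_chips_maximal[OF assms(1) st(2) assms(3,4)]
      skeletal_chips_maximal[OF assms(2) st(1) shift_cong_sym[OF assms(3)] assms(4)] by simp
  moreover obtain c where "E = rot a b D c"
    using shift_cong_imp_rot[OF stable_residues[OF st(2)] assms(3)] .
  ultimately show ?thesis
    using rot_chips_eq_imp_eq[OF stable_residues[OF st(1)], of c] by simp
qed

section \<open>Existence\<close>

text \<open>Every firing lowers the number of chips, which stays nonnegative along legal
  moves.\<close>

lemma legal_steps_to_stable:
  assumes "D \<in> configs b" "nonneg b D"
  shows "\<exists>E. stable a b k E \<and> (legal_step a b)\<^sup>*\<^sup>* D E"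
  using assms
proof (induction "nat (chips b D)" arbitrary: D rule: less_induct)
  case less
  show ?case
  proof (cases "stable a b k D")
    case True
    then show ?thesis by blast
  next
    case False
    then obtain S where S: "S \<subseteq> {1..b}" "0 < card S" "legal b (fire a b S) D"
      using less.prems unfolding stable_def by blast
    then have S0: "S \<noteq> {}" by auto
    from S(3) have nn: "nonneg b (fire a b S D)" by (simp add: legal_def)
    have "nat (chips b (fire a b S D)) < nat (chips b D)"
      using chips_fire_less[OF S(1) S0, of D] nonneg_chips[OF nn] by simp
    then obtain E where "stable a b k E" "(legal_step a b)\<^sup>*\<^sup>* (fire a b S D) E"
      using less.hyps[OF _ fire_in_configs nn] by blast
    then show ?thesis
      using legal_stepI(1)[OF S(1,3)] by (blast intro: converse_rtranclp_into_rtranclp)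
  qed
qed

text \<open>Every nonempty borrow raises the number of chips, which is at most \<open>b * a\<close>
  on stable configurations because their entries are below \<open>a\<close>.\<close>

lemma stable_legal_steps_to_skeletal:
  assumes "stable a b k D"
  shows "\<exists>E. skeletal a b k E \<and> (legal_step a b)\<^sup>*\<^sup>* D E"
  using assms
proof (induction "nat (int b * int a - chips b D)" arbitrary: D rule: less_induct)
  case less
  show ?case
  proof (cases "skeletal a b k D")
    case True
    then show ?thesis by blast
  next
    case False
    then obtain T where T: "T \<subseteq> {1..b}" "T \<noteq> {}" "legal b (borrow a b T) D"
      "stable a b k (borrow a b T D)"
      using less.prems unfolding skeletal_def by blast
    have "D \<in> configs b" using less.prems by (simp add: stable_def)
    then have "nat (int b * int a - chips b (borrow a b T D)) < nat (int b * int a - chips b D)"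
      using chips_borrow_less[OF T(1,2)] chips_residues_le[OF stable_residues[OF T(4)]] by fastforce
    from less.hyps[OF this T(4)] show ?thesis
      using legal_stepI(2)[OF T(1,3)] by (blast intro: converse_rtranclp_into_rtranclp)
  qed
qed

lemma legal_steps_to_skeletal:
  assumes "D \<in> configs b" "nonneg b D"
  shows "\<exists>E. skeletal a b k E \<and> (legal_step a b)\<^sup>*\<^sup>* D E"
  using legal_steps_to_stable[OF assms] stable_legal_steps_to_skeletal
  by (blast intro: rtranclp_trans)

lemma steps_to_nonneg:
  assumes "D \<in> configs b"
  shows "\<exists>E. E \<in> configs b \<and> nonneg b E \<and> (step a b)\<^sup>*\<^sup>* D E"
proof -
  define up where "up = borrow a b {1..b}"
  \<comment> \<open>Hence borrowing the full vertex set adds exactly one chip everywhere.\<close>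
  have gain_b: "gain a b b = int a - 1"
    using b_pos by (intro gain_eqI) (auto simp: algebra_simps)
  have up: "E \<in> configs b \<Longrightarrow> i \<in> {1..b} \<Longrightarrow> up E i = E i + 1" for E i
    unfolding up_def using borrow_apply[of "{1..b}" i E] b_pos by (simp add: gain_b)
  have iter: "(up ^^ n) D \<in> configs b \<and> (step a b)\<^sup>*\<^sup>* D ((up ^^ n) D)
      \<and> (\<forall>i\<in>{1..b}. (up ^^ n) D i = D i + int n)" for n
  proof (induction n)
    case 0
    then show ?case using assms by simp
  next
    case (Suc n)
    have "up E \<in> configs b" if "E \<in> configs b" for E
      using that borrow_in_configs by (simp add: up_def)
    moreover have "step a b E (up E)" for E
      unfolding step_def moves_def up_def by blast
    ultimately show ?case
      using Suc up by (auto intro: rtranclp.rtrancl_into_rtrancl)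
  qed
  \<comment> \<open>The sum of absolute values dominates the debt of each single vertex.\<close>
  define n where "n = nat (\<Sum>i\<in>{1..b}. \<bar>D i\<bar>)"
  have "0 \<le> D i + int n" if "i \<in> {1..b}" for i
  proof -
    have "\<bar>D i\<bar> \<le> (\<Sum>i\<in>{1..b}. \<bar>D i\<bar>)" using that by (intro member_le_sum) auto
    then show ?thesis by (simp add: n_def)
  qed
  then have "nonneg b ((up ^^ n) D)" using iter by (simp add: nonneg_def)
  then show ?thesis using iter by blast
qed

lemma steps_to_skeletal:
  assumes "D \<in> configs b"
  shows "\<exists>E. skeletal a b k E \<and> (step a b)\<^sup>*\<^sup>* D E"
  using steps_to_nonneg[OF assms] legal_steps_to_skeletal legal_steps_imp_steps
  by (blast intro: rtranclp_trans)

lemma reachable_skeletal_unique: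
  assumes "D \<in> configs b" "k < b" "skeletal a b k E" "(step a b)\<^sup>*\<^sup>* D E"
    "skeletal a b k F" "(step a b)\<^sup>*\<^sup>* D F"
  shows "E = F"
proof -
  have "shift_cong a b D E" "shift_cong a b D F"
    using steps_configs_shift_cong assms(1,4,6) by blast+
  then show ?thesis
    using skeletal_unique[OF assms(3,5) _ assms(2)] shift_cong_sym shift_cong_trans by blast
qed

section \<open>Duality between superstable and 0-skeletal configurations\<close>

text \<open>Write \<open>M\<close> for \<open>int a - 1 - int a div int b\<close>. Since
  \<open>D \<ge> 0\<close>, entries of the dual are at most \<open>M\<close>, too few for a single
  vertex to fire. Complementing against \<open>M\<close> turns a borrow of \<open>T\<close> on the
  dual into firing \<open>T\<close> on \<open>D\<close>. If the borrow produced a 0-stable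
  configuration, its entries would be at most \<open>M\<close>, so \<open>T\<close> could fire
  legally on \<open>D\<close>.\<close>

lemma dual_superstable:
  assumes b: "1 < b" and D: "superstable a b D"
  shows "skeletal a b 0 (dual a b D)"
proof -
  have g1: "gain a b 1 = int a div int b"
    using gain_eq_div[of 1] b by simp
  have Dc: "D \<in> configs b" and nn: "nonneg b D"
    using D by (auto simp: superstable_def stable_def)
  have Fc: "dual a b D \<in> configs b" by (simp add: dual_def configs_def)
  have bound: "stable a b k E \<Longrightarrow> i \<in> {1..b} \<Longrightarrow> 0 \<le> int a - 1 - int a div int b - E i" for k E i
    using stable_below_gain[of k E i] unfolding g1 by simp
  have nnF: "nonneg b (dual a b D)"
    using bound D by (auto simp: nonneg_def dual_def superstable_def)
  have "stable a b 0 (dual a b D)"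
  proof -
    have "\<not> legal b (fire a b S) (dual a b D)" if S: "S \<subseteq> {1..b}" "0 < card S" "card S \<le> 0 + 1" for S
    proof
      assume "legal b (fire a b S) (dual a b D)"
      have "card S = 1" using S by simp
      then obtain i where i: "S = {i}" by (rule card_1_singletonE)
      then have "int a - gain a b 1 \<le> dual a b D i"
        using \<open>legal _ _ _\<close> nonneg_fire_iff[OF S(1) _ nnF] by (simp add: legal_def)
      moreover have "0 \<le> D i" using nn S(1) i by (auto simp: nonneg_def)
      ultimately show False using S(1) unfolding g1 by (simp add: dual_def i)
    qed
    then show ?thesis using Fc nnF by (simp add: stable_def)
  qed
  moreover have "\<not> stable a b 0 (borrow a b T (dual a b D))"
    if T: "T \<subseteq> {1..b}" "T \<noteq> {}" for T
  proof
    assume st: "stable a b 0 (borrow a b T (dual a b D))"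
    have "fire a b T D i = int a - 1 - int a div int b - borrow a b T (dual a b D) i"
      if "i \<in> {1..b}" for i
      using that fire_apply[OF T that, of D] borrow_apply[OF T that Fc] by (simp add: dual_def)
    then have "nonneg b (fire a b T D)" using bound[OF st] by (simp add: nonneg_def)
    then have "legal b (fire a b T) D" using nn by (simp add: legal_def)
    then show False
      using D T card_range[OF T] unfolding superstable_def stable_def by auto
  qed
  ultimately show ?thesis by (simp add: skeletal_def)
qed

end

section \<open>Symmetry under permutations of the vertices\<close>

text \<open>A complete invariant of orbits under vertex permutations, by
  \<open>vals_perm_act\<close> and \<open>vals_eq_imp_perm_act\<close>.\<close>

definition vals :: "nat \<Rightarrow> (nat \<Rightarrow> int) \<Rightarrow> int multiset" where
  "vals b D = image_mset D (mset_set {1..b})"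

lemma chips_eq_sum_mset_vals: "chips b D = sum_mset (vals b D)"
  by (simp add: chips_def vals_def sum_unfold_sum_mset)

lemma perm_act_apply: "D \<in> configs b \<Longrightarrow> perm_act b p D i = D (inv_into UNIV p i)"
  by (simp add: perm_act_def)

lemma perm_act_configs: "p permutes {1..b} \<Longrightarrow> D \<in> configs b \<Longrightarrow> perm_act b p D \<in> configs b"
  using perm_act_in_configs by (simp add: perm_act_def)

lemma perm_act_inv:
  assumes "p permutes {1..b}" "D \<in> configs b"
  shows "perm_act b (inv_into UNIV p) (perm_act b p D) = D"
    and "perm_act b p (perm_act b (inv_into UNIV p) D) = D"
proof -
  have "perm_act b id D = D" using assms(2) by (simp add: perm_act_def)
  then show "perm_act b (inv_into UNIV p) (perm_act b p D) = D"
    and "perm_act b p (perm_act b (inv_into UNIV p) D) = D"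
    using perm_act_comp[OF permutes_inv[OF assms(1)] assms]
      perm_act_comp[OF assms(1) permutes_inv[OF assms(1)] assms(2)] permutes_inv_o[OF assms(1)]
    by simp_all
qed

lemma vals_perm_act:
  assumes "p permutes {1..b}" "D \<in> configs b"
  shows "vals b (perm_act b p D) = vals b D"
  unfolding vals_def
  using assms by (intro permutes_implies_image_mset_eq[OF assms(1)])
    (simp add: perm_act_apply permutes_inverses(2)[OF assms(1)])

lemma vals_eq_imp_perm_act:
  assumes "v \<in> configs b" "w \<in> configs b" "vals b v = vals b w"
  obtains p where "p permutes {1..b}" "w = perm_act b p v"
proof -
  obtain p where p: "p permutes {1..b}" "\<forall>x\<in>{1..b}. v x = w (p x)"
    using image_mset_eq_implies_permutes[of "{1..b}" v w] assms(3) unfolding vals_def by auto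
  have "w = perm_act b p v"
  proof (rule configs_eqI[OF assms(2) perm_act_configs[OF p(1) assms(1)]])
    fix i assume "i \<in> {1..b}"
    then have "inv_into UNIV p i \<in> {1..b}"
      using permutes_in_image[OF permutes_inv[OF p(1)]] by simp
    then show "w i = perm_act b p v i"
      using p(2) by (simp add: perm_act_apply assms(1) permutes_inverses(1)[OF p(1)])
  qed
  then show ?thesis using that p(1) by blast
qed

lemma fire_perm_act:
  assumes p: "p permutes {1..b}" and D: "D \<in> configs b"
  shows "fire a b (p ` S) (perm_act b p D) = perm_act b p (fire a b S D)"
proof (rule configs_eqI[OF fire_in_configs perm_act_configs[OF p fire_in_configs]])
  fix i assume i: "i \<in> {1..b}"
  then have ii: "inv_into UNIV p i \<in> {1..b}"
    using permutes_in_image[OF permutes_inv[OF p]] by simp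
  have "card (p ` S) = card S"
    by (rule card_image) (meson inj_on_subset permutes_inj[OF p] subset_UNIV)
  moreover have "i \<in> p ` S \<longleftrightarrow> inv_into UNIV p i \<in> S"
    by (metis image_iff permutes_inverses[OF p])
  ultimately show "fire a b (p ` S) (perm_act b p D) i = perm_act b p (fire a b S D) i"
    using i ii perm_act_apply[OF fire_in_configs, of b p a S D i]
    by (simp add: fire_def perm_act_apply[OF D])
qed

lemma borrow_perm_act:
  assumes p: "p permutes {1..b}" and D: "D \<in> configs b"
  shows "borrow a b (p ` S) (perm_act b p D) = perm_act b p (borrow a b S D)"
  using fire_perm_act[OF p borrow_in_configs[OF D], of a S a S]
    borrow_fire[OF perm_act_configs[OF p borrow_in_configs[OF D]], of a "p ` S" a S]
  by (simp add: fire_borrow[OF D])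

lemma nonneg_perm_act:
  assumes p: "p permutes {1..b}" and D: "D \<in> configs b"
  shows "nonneg b (perm_act b p D) \<longleftrightarrow> nonneg b D"
proof -
  have "(\<forall>i\<in>{1..b}. 0 \<le> D (inv_into UNIV p i)) \<longleftrightarrow> (\<forall>i\<in>inv_into UNIV p ` {1..b}. 0 \<le> D i)"
    by blast
  then show ?thesis
    unfolding permutes_image[OF permutes_inv[OF p]] nonneg_def perm_act_apply[OF D] .
qed

lemma legal_fire_perm_act:
  assumes "p permutes {1..b}" "D \<in> configs b"
  shows "legal b (fire a b (p ` S)) (perm_act b p D) \<longleftrightarrow> legal b (fire a b S) D"
  unfolding legal_def fire_perm_act[OF assms] nonneg_perm_act[OF assms]
    nonneg_perm_act[OF assms(1) fire_in_configs] ..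

lemma legal_borrow_perm_act:
  assumes "p permutes {1..b}" "D \<in> configs b"
  shows "legal b (borrow a b (p ` S)) (perm_act b p D) \<longleftrightarrow> legal b (borrow a b S) D"
  unfolding legal_def borrow_perm_act[OF assms] nonneg_perm_act[OF assms]
    nonneg_perm_act[OF assms(1) borrow_in_configs[OF assms(2)]] ..

lemma permutes_subset_image:
  assumes p: "p permutes A" and "S \<subseteq> A"
  obtains S' where "S' \<subseteq> A" "S = p ` S'" "card S' = card S"
proof (rule that[of "inv_into UNIV p ` S"])
  show "inv_into UNIV p ` S \<subseteq> A"
    using assms(2) permutes_in_image[OF permutes_inv[OF p]] by blast
  show "S = p ` inv_into UNIV p ` S"
    by (simp add: image_image permutes_inverses(1)[OF p])
  show "card (inv_into UNIV p ` S) = card S"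
    by (rule card_image) (meson inj_on_subset permutes_inj[OF permutes_inv[OF p]] subset_UNIV)
qed

lemma stable_perm_act:
  assumes p: "p permutes {1..b}" and D: "stable a b k D"
  shows "stable a b k (perm_act b p D)"
proof -
  have Dc: "D \<in> configs b" using D by (simp add: stable_def)
  have "\<not> legal b (fire a b S) (perm_act b p D)"
    if S: "S \<subseteq> {1..b}" "0 < card S" "card S \<le> k + 1" for S
  proof -
    obtain S' where "S' \<subseteq> {1..b}" "S = p ` S'" "card S' = card S"
      using permutes_subset_image[OF p S(1)] .
    then show ?thesis
      using D S by (simp add: legal_fire_perm_act[OF p Dc] stable_def)
  qed
  then show ?thesis
    using D perm_act_configs[OF p Dc] nonneg_perm_act[OF p Dc] by (simp add: stable_def)
qed

lemma skeletal_perm_act: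
  assumes p: "p permutes {1..b}" and D: "skeletal a b k D"
  shows "skeletal a b k (perm_act b p D)"
proof -
  have Dc: "D \<in> configs b" using D by (simp add: stable_def skeletal_def)
  have "\<not> stable a b k (borrow a b T (perm_act b p D))"
    if T: "T \<subseteq> {1..b}" "T \<noteq> {}" "legal b (borrow a b T) (perm_act b p D)" for T
  proof
    assume st: "stable a b k (borrow a b T (perm_act b p D))"
    obtain T' where T': "T' \<subseteq> {1..b}" "T = p ` T'"
      using permutes_subset_image[OF p T(1)] .
    have "stable a b k (borrow a b T' D)"
      using stable_perm_act[OF permutes_inv[OF p] st]
      by (simp add: T'(2) borrow_perm_act[OF p Dc] perm_act_inv[OF p borrow_in_configs[OF Dc]])
    moreover have "legal b (borrow a b T') D"
      using T(3) by (simp add: T'(2) legal_borrow_perm_act[OF p Dc])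
    ultimately show False using D T(2) T' by (auto simp: skeletal_def)
  qed
  then show ?thesis
    using D stable_perm_act[OF p] by (simp add: skeletal_def)
qed

lemma shift_cong_perm_act:
  assumes p: "p permutes {1..b}" and "D \<in> configs b" "E \<in> configs b" "shift_cong a b D E"
  shows "shift_cong a b (perm_act b p D) (perm_act b p E)"
proof -
  obtain c where c: "\<And>i. i \<in> {1..b} \<Longrightarrow> [E i = D i + c] (mod int a)"
    using assms(4) unfolding shift_cong_def by blast
  have "[perm_act b p E i = perm_act b p D i + c] (mod int a)" if "i \<in> {1..b}" for i
    using c[of "inv_into UNIV p i"] that permutes_in_image[OF permutes_inv[OF p], of i]
    by (simp add: perm_act_apply assms(2,3))
  then show ?thesis unfolding shift_cong_def by blast
qed

lemma residues_perm_act: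
  assumes p: "p permutes {1..b}" and v: "v \<in> residues a b"
  shows "perm_act b p v \<in> residues a b"
proof -
  have "perm_act b p v i \<in> {0..<int a}" if "i \<in> {1..b}" for i
    using v that permutes_in_image[OF permutes_inv[OF p], of i]
    by (simp add: perm_act_apply residues_configs[OF v]) (auto simp: residues_def PiE_iff)
  then show ?thesis
    using perm_act_configs[OF p residues_configs[OF v]]
    by (simp add: residues_def configs_def PiE_iff)
qed

section \<open>Zero-sum representatives and counting\<close>

text \<open>A vanishing sum modulo \<open>a\<close> is a condition symmetric in the vertices. The
  resulting normal form of a class therefore commutes with permutations, unlike one that fixes the
  value at a chosen vertex.\<close>

definition zero_sum :: "nat \<Rightarrow> nat \<Rightarrow> (nat \<Rightarrow> int) set" where
  "zero_sum a b = {v \<in> residues a b. int a dvd chips b v}"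

definition zero_rep :: "nat \<Rightarrow> nat \<Rightarrow> (nat \<Rightarrow> int) \<Rightarrow> (nat \<Rightarrow> int)" where
  "zero_rep a b D = (THE v. v \<in> zero_sum a b \<and> shift_cong a b D v)"

text \<open>Both images are in bijection with the quotient of \<open>A\<close> by the common kernel.
  It serves to replace orbits by multisets of values.\<close>

lemma card_image_eq_if_same_kernel:
  assumes "\<And>x y. x \<in> A \<Longrightarrow> y \<in> A \<Longrightarrow> f x = f y \<longleftrightarrow> g x = g y"
  shows "card (f ` A) = card (g ` A)"
proof -
  let ?F = "\<lambda>z. g (inv_into A f z)" and ?G = "\<lambda>z. f (inv_into A g z)"
  have f: "inv_into A f (f x) \<in> A" "f (inv_into A f (f x)) = f x" if "x \<in> A" for x
    using that by (auto intro: inv_into_into f_inv_into_f)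
  have g: "inv_into A g (g x) \<in> A" "g (inv_into A g (g x)) = g x" if "x \<in> A" for x
    using that by (auto intro: inv_into_into f_inv_into_f)
  have F: "?F (f x) = g x" and G: "?G (g x) = f x" if "x \<in> A" for x
    using assms f[OF that] g[OF that] that by blast+
  have "bij_betw ?F (f ` A) (g ` A)"
    by (rule bij_betw_byWitness[where f' = ?G]) (auto simp: F G)
  then show ?thesis by (rule bij_betw_same_card)
qed

text \<open>The shift by \<open>r\<close> changes the weight by \<open>b * r\<close>, so it permutes the \<open>a\<close> residue classes of
  the weight transitively.\<close>

lemma card_zero_fibre:
  fixes T :: "int \<Rightarrow> 'x \<Rightarrow> 'x" and w :: "'x \<Rightarrow> int"
  assumes "finite X" "0 < a" "coprime a b"
    and T: "\<And>x c. x \<in> X \<Longrightarrow> T c x \<in> X" "\<And>x c. x \<in> X \<Longrightarrow> T (- c) (T c x) = x"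
    and w: "\<And>x c. x \<in> X \<Longrightarrow> [w (T c x) = w x + int b * c] (mod int a)"
  shows "a * card {x\<in>X. int a dvd w x} = card X"
proof -
  define F where "F r = {x\<in>X. int a dvd w x + int b * r}" for r
  have cop: "coprime (int b) (int a)" using assms(3) by (simp add: coprime_commute)
  have "X \<subseteq> (\<Union>r\<in>{0..<int a}. F r)"
  proof
    fix x assume x: "x \<in> X"
    obtain y where y: "[int b * y = 1] (mod int a)"
      using cong_solve_coprime_int[OF cop] by blast
    \<comment> \<open>With \<open>y\<close> inverse to \<open>b\<close> modulo \<open>a\<close>,
      this solves \<open>w x + b r = 0\<close> modulo \<open>a\<close>.\<close>
    define r where "r = (- w x * y) mod int a"
    have "[w x + int b * r = w x + int b * (- w x * y)] (mod int a)"
      unfolding r_def by (intro cong_add cong_mult cong_refl) simp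
    also have "w x + int b * (- w x * y) = w x + - w x * (int b * y)" by simp
    also have "[w x + - w x * (int b * y) = w x + - w x * 1] (mod int a)"
      by (intro cong_add cong_mult cong_refl y)
    finally have "int a dvd w x + int b * r" by (simp add: cong_0_iff)
    moreover have "r \<in> {0..<int a}" using assms(2) by (simp add: r_def)
    ultimately show "x \<in> (\<Union>r\<in>{0..<int a}. F r)" using x by (auto simp: F_def)
  qed
  then have "X = (\<Union>r\<in>{0..<int a}. F r)" by (auto simp: F_def)
  moreover have "F r \<inter> F s = {}" if "r \<in> {0..<int a}" "s \<in> {0..<int a}" "r \<noteq> s" for r s
  proof (rule ccontr)
    assume "F r \<inter> F s \<noteq> {}"
    then obtain x where "int a dvd w x + int b * r" "int a dvd w x + int b * s"
      by (auto simp: F_def)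
    then have "int a dvd (w x + int b * r) - (w x + int b * s)" by (rule dvd_diff)
    then have "int a dvd int b * (r - s)" by (simp add: algebra_simps)
    then have "int a dvd r - s"
      using cop by (simp add: coprime_commute coprime_dvd_mult_right_iff)
    then have "r mod int a = s mod int a" by (simp add: mod_eq_dvd_iff)
    then show False using that by simp
  qed
  moreover have "card (F r) = card (F 0)" for r
  proof (rule bij_betw_same_card[OF bij_betw_byWitness[where f = "T r" and f' = "T (- r)"]])
    show "\<forall>x\<in>F r. T (- r) (T r x) = x" using T(2) by (simp add: F_def)
    show "\<forall>x\<in>F 0. T r (T (- r) x) = x" using T(2)[of _ "- r"] by (simp add: F_def)
    show "T r ` F r \<subseteq> F 0"
    proof
      fix z assume "z \<in> T r ` F r"
      then obtain x where x: "x \<in> X" "int a dvd w x + int b * r" "z = T r x"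
        unfolding F_def by blast
      have "int a dvd w z" unfolding x(3) cong_dvd_iff[OF w[OF x(1)]] by (rule x(2))
      then show "z \<in> F 0" using T(1)[OF x(1), of r] by (simp add: F_def x(3))
    qed
    show "T (- r) ` F 0 \<subseteq> F r"
    proof
      fix z assume "z \<in> T (- r) ` F 0"
      then obtain x where x: "x \<in> X" "int a dvd w x" "z = T (- r) x"
        by (auto simp: F_def)
      have "[w z + int b * r = w x + int b * - r + int b * r] (mod int a)"
        unfolding x(3) by (intro cong_add cong_refl w x(1))
      then have "int a dvd w z + int b * r" using x(2) by (simp add: cong_dvd_iff)
      then show "z \<in> F r" using T(1)[OF x(1), of "- r"] by (simp add: F_def x(3))
    qed
  qed
  moreover have "finite (F r)" for r using assms(1) by (simp add: F_def)
  ultimately have "card X = (\<Sum>r\<in>{0..<int a}. card (F 0))"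
    using card_UN_disjoint[of "{0..<int a}" F] by (metis (no_types, lifting) finite_atLeastLessThan_int sum.cong)
  then show ?thesis by (simp add: F_def)
qed

lemma sum_mset_shift_cong:
  "[sum_mset (image_mset (\<lambda>x. (x + c) mod m) M) = sum_mset M + int (size M) * c] (mod m)"
proof (induction M)
  case empty
  then show ?case by simp
next
  case (add x M)
  have "[(x + c) mod m + sum_mset (image_mset (\<lambda>x. (x + c) mod m) M)
      = (x + c) + (sum_mset M + int (size M) * c)] (mod m)"
    by (rule cong_add[OF _ add]) simp
  then show ?case by (simp add: algebra_simps)
qed

lemma vals_zero_sum:
  "vals b ` zero_sum a b = {M \<in> multisets_of_size {0..<int a} b. int a dvd sum_mset M}"
proof
  show "vals b ` zero_sum a b \<subseteq> {M \<in> multisets_of_size {0..<int a} b. int a dvd sum_mset M}"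
    unfolding zero_sum_def chips_eq_sum_mset_vals
    by (auto simp: multisets_of_size_def vals_def residues_def PiE_iff)
  show "{M \<in> multisets_of_size {0..<int a} b. int a dvd sum_mset M} \<subseteq> vals b ` zero_sum a b"
  proof
    fix M assume "M \<in> {M \<in> multisets_of_size {0..<int a} b. int a dvd sum_mset M}"
    then have M: "set_mset M \<subseteq> {0..<int a}" "size M = b" "int a dvd sum_mset M"
      by (auto simp: multisets_of_size_def)
    obtain xs where xs: "mset xs = M" using ex_mset by blast
    then have len: "length xs = b" using M(2) by auto
    \<comment> \<open>Vertices are numbered from 1, list positions from 0.\<close>
    define v where "v = (\<lambda>i\<in>{1..b}. xs ! (i - 1))"
    have "map v [1..<Suc b] = xs"
      by (rule nth_equalityI) (auto simp: len v_def simp del: upt_Suc)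
    then have vM: "vals b v = M"
      unfolding vals_def xs[symmetric]
      by (metis atLeastLessThanSuc_atLeastAtMost mset_map mset_upt)
    have "v i \<in> {0..<int a}" if "i \<in> {1..b}" for i
    proof -
      have "v i \<in> set xs" using that len by (auto simp: v_def)
      then show ?thesis using M(1) xs by auto
    qed
    then have "v \<in> residues a b"
      by (simp add: residues_def PiE_iff) (simp add: v_def)
    then show "M \<in> vals b ` zero_sum a b"
      using vM M(3) by (auto simp: zero_sum_def chips_eq_sum_mset_vals)
  qed
qed

lemma zero_sum_configs: "v \<in> zero_sum a b \<Longrightarrow> v \<in> configs b"
  unfolding zero_sum_def by (blast intro: residues_configs)

context
  fixes a b :: nat
  assumes a_pos: "0 < a" and b_pos: "0 < b" and coprime_ab: "coprime a b"
begin

lemma card_zero_sum: "card (zero_sum a b) = a ^ (b - 1)"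
proof -
  have "finite (residues a b)" by (auto simp: residues_def intro!: finite_PiE)
  then have "a * card {v \<in> residues a b. int a dvd chips b v} = card (residues a b)"
    by (rule card_zero_fibre[where T = "\<lambda>c v. rot a b v c", OF _ a_pos coprime_ab])
      (auto simp: rot_rot rot_0 rot_residues[OF a_pos b_pos coprime_ab] chips_rot_cong)
  also have "\<dots> = a * a ^ (b - 1)"
    using b_pos by (simp add: residues_def card_PiE flip: power_Suc)
  finally show ?thesis using a_pos by (simp add: zero_sum_def)
qed

text \<open>A cyclic shift of all values changes the sum of a multiset of size \<open>b\<close> by
  \<open>b c\<close> modulo \<open>a\<close>, so \<open>card_zero_fibre\<close> applies to multisets
  just as to vectors.\<close>

lemma card_vals_zero_sum: "a * card (vals b ` zero_sum a b) = (a + b - 1) choose b"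
proof -
  let ?T = "\<lambda>c. image_mset (\<lambda>x. (x + c) mod int a)"
  have "a * card {M \<in> multisets_of_size {0..<int a} b. int a dvd sum_mset M}
      = card (multisets_of_size {0..<int a} b)"
  proof (rule card_zero_fibre[where T = ?T, OF _ a_pos coprime_ab])
    fix M c assume M: "M \<in> multisets_of_size {0..<int a} b"
    show "?T c M \<in> multisets_of_size {0..<int a} b"
      using M a_pos by (auto simp: multisets_of_size_def)
    have "?T (- c) (?T c M) = image_mset (\<lambda>x. x) M"
      unfolding multiset.map_comp
      using M by (intro image_mset_cong) (auto simp: multisets_of_size_def mod_simps)
    then show "?T (- c) (?T c M) = M" by simp
    show "[sum_mset (?T c M) = sum_mset M + int b * c] (mod int a)"
      using sum_mset_shift_cong[of c "int a" M] M by (simp add: multisets_of_size_def)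
  qed auto
  then show ?thesis by (simp add: vals_zero_sum card_multisets_of_size)
qed

lemma zero_sum_unique:
  assumes "v \<in> zero_sum a b" "w \<in> zero_sum a b" "shift_cong a b v w"
  shows "v = w"
proof -
  have v: "v \<in> residues a b" "int a dvd chips b v" and w: "w \<in> residues a b" "int a dvd chips b w"
    using assms(1,2) by (auto simp: zero_sum_def)
  obtain c where "w = rot a b v c" using shift_cong_imp_rot[OF w(1) assms(3)] .
  moreover have "[chips b w = chips b v] (mod int a)"
    using v(2) w(2) by (simp add: cong_def)
  ultimately show ?thesis
    using rot_chips_eq_imp_eq[OF a_pos b_pos coprime_ab v(1), of c] by simp
qed

lemma ex1_zero_rep: "\<exists>!v. v \<in> zero_sum a b \<and> shift_cong a b D v"
proof (rule ex_ex1I)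
  have "coprime (int b) (int a)" using coprime_ab by (simp add: coprime_commute)
  then obtain y where y: "[int b * y = 1] (mod int a)"
    using cong_solve_coprime_int by blast
  \<comment> \<open>Since \<open>y\<close> inverts \<open>b\<close> modulo \<open>a\<close>,
    rotating by this amount cancels the number of chips modulo \<open>a\<close>.\<close>
  let ?c = "- chips b D * y"
  have "[chips b D + int b * ?c = chips b D + - chips b D * 1] (mod int a)"
    using cong_add[OF cong_refl cong_mult[OF cong_refl[of "- chips b D"] y], of "chips b D"]
    by (simp add: algebra_simps)
  from cong_trans[OF chips_rot_cong this] have "int a dvd chips b (rot a b D ?c)"
    by (simp add: cong_0_iff)
  then show "\<exists>v. v \<in> zero_sum a b \<and> shift_cong a b D v"
    using rot_residues[OF a_pos b_pos coprime_ab] rot_shift_cong unfolding zero_sum_def by blast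
qed (use zero_sum_unique shift_cong_sym shift_cong_trans in blast)

lemma zero_rep: "zero_rep a b D \<in> zero_sum a b" "shift_cong a b D (zero_rep a b D)"
  using theI'[OF ex1_zero_rep[of D]] by (simp_all add: zero_rep_def)

lemma zero_rep_eqI: "v \<in> zero_sum a b \<Longrightarrow> shift_cong a b D v \<Longrightarrow> zero_rep a b D = v"
  using ex1_zero_rep[of D] zero_rep[of D] by blast

section \<open>Transfer from zero-sum vectors to skeletal configurations\<close>

lemma zero_rep_perm_act:
  assumes p: "p permutes {1..b}" and D: "D \<in> configs b"
  shows "zero_rep a b (perm_act b p D) = perm_act b p (zero_rep a b D)"
proof (rule zero_rep_eqI)
  note z = zero_rep[of D] and zc = zero_sum_configs[OF zero_rep(1)[of D]]
  show "perm_act b p (zero_rep a b D) \<in> zero_sum a b"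
    using z(1) residues_perm_act[OF p]
    by (simp add: zero_sum_def chips_eq_sum_mset_vals vals_perm_act[OF p zc])
  show "shift_cong a b (perm_act b p D) (perm_act b p (zero_rep a b D))"
    by (rule shift_cong_perm_act[OF p D zc z(2)])
qed

text \<open>Both sides contain exactly one element of each congruence class. Surjectivity comes from
  moving a zero-sum vector to a skeletal configuration, which stays in its class.\<close>

lemma bij_betw_zero_rep:
  assumes "k < b"
  shows "bij_betw (zero_rep a b) {D. skeletal a b k D} (zero_sum a b)"
proof (rule bij_betw_imageI)
  show "inj_on (zero_rep a b) {D. skeletal a b k D}"
  proof (rule inj_onI)
    fix D E assume "D \<in> {D. skeletal a b k D}" "E \<in> {D. skeletal a b k D}"
      and "zero_rep a b D = zero_rep a b E"
    then show "D = E"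
      using skeletal_unique[OF a_pos b_pos coprime_ab _ _ _ assms, of D E]
        shift_cong_trans[OF zero_rep(2)[of D]] shift_cong_sym[OF zero_rep(2)[of E]] by simp
  qed
  have "v \<in> zero_rep a b ` {D. skeletal a b k D}" if v: "v \<in> zero_sum a b" for v
  proof -
    obtain E where E: "skeletal a b k E" "(step a b)\<^sup>*\<^sup>* v E"
      using steps_to_skeletal[OF a_pos b_pos coprime_ab zero_sum_configs[OF v]] by blast
    then have "shift_cong a b v E"
      using steps_configs_shift_cong[OF a_pos b_pos coprime_ab _ zero_sum_configs[OF v]] by blast
    then have "zero_rep a b E = v" using zero_rep_eqI[OF v] shift_cong_sym by blast
    then show ?thesis using E(1) by blast
  qed
  then show "zero_rep a b ` {D. skeletal a b k D} = zero_sum a b"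
    using zero_rep(1) by blast
qed

lemma card_skeletal: "k < b \<Longrightarrow> card {D. skeletal a b k D} = a ^ (b - 1)"
  using bij_betw_same_card[OF bij_betw_zero_rep] card_zero_sum by simp

text \<open>On skeletal configurations \<open>zero_rep\<close> is injective and commutes with
  permutations, so it carries orbits to orbits of zero-sum vectors, which \<open>vals\<close>
  separates.\<close>

lemma orbit_eq_iff:
  assumes k: "k < b" and D: "skeletal a b k D" and E: "skeletal a b k E"
  shows "orbit (sym_group b) (perm_act b) D = orbit (sym_group b) (perm_act b) E
    \<longleftrightarrow> vals b (zero_rep a b D) = vals b (zero_rep a b E)" (is "?orb D = ?orb E \<longleftrightarrow> ?R")
proof -
  interpret group_action "sym_group b" "configs b" "perm_act b"
    by (rule perm_act_group_action)
  have Dc: "D \<in> configs b" and Ec: "E \<in> configs b"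
    using D E by (auto simp: skeletal_def stable_def)
  have mem: "F \<in> ?orb G \<longleftrightarrow> (\<exists>p. p permutes {1..b} \<and> F = perm_act b p G)" for F G
    by (auto simp: orbit_def sym_group_carrier)
  have "?orb D = ?orb E \<longleftrightarrow> E \<in> ?orb D"
  proof
    assume EorbD: "E \<in> ?orb D"
    have sub: "?orb F \<subseteq> ?orb G" if "F \<in> configs b" "G \<in> configs b" "F \<in> ?orb G" for F G
    proof
      fix H assume H: "H \<in> ?orb F"
      then obtain p where "p permutes {1..b}" "H = perm_act b p F" unfolding mem by blast
      then have "H \<in> configs b" using perm_act_configs that(1) by simp
      from orbit_trans[OF that(2,1) this that(3) H] show "H \<in> ?orb G" .
    qed
    show "?orb D = ?orb E"
      using sub[OF Ec Dc EorbD] sub[OF Dc Ec orbit_sym[OF Dc Ec EorbD]] by blast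
  qed (use orbit_refl[OF Ec] in simp)
  also have "\<dots> \<longleftrightarrow> ?R"
  proof
    assume "E \<in> ?orb D"
    then obtain p where "p permutes {1..b}" "E = perm_act b p D" unfolding mem by blast
    then show ?R
      using vals_perm_act[OF _ zero_sum_configs[OF zero_rep(1)]] zero_rep_perm_act[OF _ Dc] by simp
  next
    assume ?R
    then obtain p where p: "p permutes {1..b}" "zero_rep a b E = perm_act b p (zero_rep a b D)"
      using vals_eq_imp_perm_act zero_sum_configs zero_rep(1) by metis
    then have "zero_rep a b E = zero_rep a b (perm_act b p D)"
      by (simp only: zero_rep_perm_act[OF p(1) Dc])
    \<comment> \<open>Injectivity applies because the permuted configuration is again
      skeletal.\<close>
    then have "E = perm_act b p D"
      using bij_betw_imp_inj_on[OF bij_betw_zero_rep[OF k]] E skeletal_perm_act[OF p(1) D]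
      by (auto dest: inj_onD)
    then show "E \<in> ?orb D" unfolding mem using p(1) by blast
  qed
  finally show ?thesis .
qed

lemma card_orbits_skeletal:
  assumes "k < b"
  shows "real (card (orbits (sym_group b) {D. skeletal a b k D} (perm_act b)))
    = 1 / real (a + b) * real ((a + b) choose a)"
proof -
  let ?S = "{D. skeletal a b k D}"
  define N where "N = card (orbits (sym_group b) ?S (perm_act b))"
  have "orbits (sym_group b) ?S (perm_act b) = orbit (sym_group b) (perm_act b) ` ?S"
    by (auto simp: orbits_def)
  then have "N = card ((\<lambda>D. vals b (zero_rep a b D)) ` ?S)"
    unfolding N_def
    by (simp only:) (rule card_image_eq_if_same_kernel, simp add: orbit_eq_iff[OF assms])
  also have "\<dots> = card (vals b ` zero_sum a b)"
    unfolding bij_betw_imp_surj_on[OF bij_betw_zero_rep[OF assms], symmetric] image_image ..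
  finally have N: "a * N = (a + b - 1) choose b" using card_vals_zero_sum by simp
  \<comment> \<open>Absorption and symmetry of binomial coefficients turn the multiset count into
    the rational Catalan number.\<close>
  have "a * ((a + b) choose a) = (a + b) * ((a + b - 1) choose (a - 1))"
    using binomial_absorption[of "a - 1" "a + b"] a_pos by simp
  also have "(a + b - 1) choose (a - 1) = (a + b - 1) choose b"
    using binomial_symmetric[of b "a + b - 1"] a_pos by simp
  finally have "a * ((a + b) choose a) = a * ((a + b) * N)" using N by simp
  then have "(a + b) choose a = (a + b) * N" using a_pos by simp
  then show ?thesis using a_pos unfolding N_def[symmetric] by simp
qed

text \<open>Superstable means \<open>(b - 1)\<close>-skeletal, and the number of
  \<open>k\<close>-skeletal configurations is the same for all \<open>k < b\<close>. An injection
  between finite sets of equal size is onto, so no inverse direction of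
  \<open>dual_superstable\<close> has to be proved.\<close>

lemma bij_betw_dual:
  assumes "1 < b"
  shows "bij_betw (dual a b) {D. superstable a b D} {D. skeletal a b 0 D}"
proof (rule bij_betw_imageI)
  have "{D. superstable a b D} \<subseteq> configs b"
    by (auto simp: superstable_def stable_def)
  then show inj: "inj_on (dual a b) {D. superstable a b D}"
    using inj_on_dual inj_on_subset by blast
  have "card {D. superstable a b D} = card {D. skeletal a b 0 D}"
    using assms superstable_iff_skeletal by (simp add: card_skeletal)
  \<comment> \<open>An infinite set has \<open>card\<close> 0, whereas the cardinality here is the
    positive number \<open>a ^ (b - 1)\<close>.\<close>
  moreover have "finite {D. skeletal a b 0 D}"
    by (rule card_ge_0_finite) (use card_skeletal[of 0] a_pos b_pos in simp)
  ultimately show "dual a b ` {D. superstable a b D} = {D. skeletal a b 0 D}"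
    using dual_superstable[OF a_pos b_pos coprime_ab assms]
    by (intro card_subset_eq) (auto simp: card_image[OF inj])
qed

end

theorem theorem1p5:
  fixes a b k :: nat
  assumes "0 < a" and "0 < b" and "coprime a b" and "k < b"
  shows
    "(\<forall>D\<in>configs b.
        (\<exists>!D'. skeletal a b k D' \<and> (step a b)\<^sup>*\<^sup>* D D') \<and>
        (nonneg b D \<longrightarrow>
          (\<forall>D'. skeletal a b k D' \<and> (step a b)\<^sup>*\<^sup>* D D' \<longrightarrow> (legal_step a b)\<^sup>*\<^sup>* D D')))
     \<and> (1 < b \<longrightarrow>
          bij_betw (\<lambda>D. \<lambda>i\<in>{1..b}. int a - 1 - int a div int b - D i)
            {D. superstable a b D} {D. skeletal a b 0 D})
     \<and> card {D. skeletal a b k D} = a ^ (b - 1)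
     \<and> real (card (orbits (sym_group b) {D. skeletal a b k D} (perm_act b)))
          = 1 / real (a + b) * real ((a + b) choose a)"
proof (intro conjI ballI impI allI)
  fix D assume D: "D \<in> configs b"
  note unique = reachable_skeletal_unique[OF assms(1-3) D assms(4)]
  show "\<exists>!D'. skeletal a b k D' \<and> (step a b)\<^sup>*\<^sup>* D D'"
  proof (rule ex_ex1I)
    show "\<exists>D'. skeletal a b k D' \<and> (step a b)\<^sup>*\<^sup>* D D'"
      by (rule steps_to_skeletal[OF assms(1-3) D])
  qed (elim conjE, rule unique)
  fix D' assume "nonneg b D" and D': "skeletal a b k D' \<and> (step a b)\<^sup>*\<^sup>* D D'"
  \<comment> \<open>The skeletal configuration found by legal moves is also reachable by arbitrary
    moves, so uniqueness identifies it with \<open>D'\<close>.\<close>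
  obtain E where E: "skeletal a b k E" "(legal_step a b)\<^sup>*\<^sup>* D E"
    using legal_steps_to_skeletal[OF assms(1-3) D \<open>nonneg b D\<close>] by blast
  then show "(legal_step a b)\<^sup>*\<^sup>* D D'"
    using unique D' legal_steps_imp_steps by blast
next
  assume "1 < b"
  then show "bij_betw (\<lambda>D. \<lambda>i\<in>{1..b}. int a - 1 - int a div int b - D i)
      {D. superstable a b D} {D. skeletal a b 0 D}"
    by (rule bij_betw_dual[OF assms(1-3), unfolded dual_def[abs_def]])
qed (rule card_skeletal[OF assms] card_orbits_skeletal[OF assms])+

end
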